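(* Let $\alpha_1,\alpha_2\in(0,1)$ and set $\alpha=\alpha_1\cdot\alpha_2$. Consider the matched pairs model with missing values described in the context, in which the completely observed data $\boldsymbol{X}^{(c)}$ and the incompletely observed data $\boldsymbol{X}^{(i)}$ are independent, and let $H_0$ be an arbitrary null hypothesis in this model. Let $\varphi^{(c)}=\varphi^{(c)}(\boldsymbol{X}^{(c)})$ be a test depending only on $\boldsymbol{X}^{(c)}$, let $\varphi^{(i)}=\varphi^{(i)}(\boldsymbol{X}^{(i)})$ be a test depending only on $\boldsymbol{X}^{(i)}$, and put $\varphi=\varphi^{(c)}\cdot\varphi^{(i)}$. (i) If $\varphi^{(c)}$ and $\varphi^{(i)}$ are level $\alpha_1$ and level $\alpha_2$ tests for $H_0$, respectively, then $\varphi$ is a level $\alpha$ test for $H_0$. Moreover, if both are exact, i.e. $E_{H_0}(\varphi^{(c)})=\alpha_1$ and $E_{H_0}(\varphi^{(i)})=\alpha_2$, then $\varphi$ is exact as well, i.e. $E_{H_0}(\varphi)=\alpha$. (ii) If $\varphi^{(c)}$ and $\varphi^{(i)}$ (now families of tests indexed by the sample sizes $n_c,n_1,n_2$) are of asymptotic level $\alpha_1$ and $\alpha_2$, respectively, i.e. $E(\varphi^{(c)})\to\alpha_1$ and $E(\varphi^{(i)})\to\alpha_2$ under $H_0$ as $\min(n_c,n_1,n_2)\to\infty$, then $\varphi$ is of asymptotic level $\alpha$ as well, i.e. $E(\varphi)\to\alpha$ under $H_0$ as $\min(n_c,n_1,n_2)\to\infty$.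
   Context: Model. Let $(X_{1j},X_{2j})'$ be i.i.d. $\mathbb{R}^2$-valued random vectors with marginal distribution functions $F_1$ (first component) and $F_2$ (second component). Some components may be missing. The data are sorted into: - $n_c$ completely observed pairs $\boldsymbol{X}^{(c)}=\big((X^{(c)}_{11},X^{(c)}_{21})',\dots,(X^{(c)}_{1n_c},X^{(c)}_{2n_c})'\big)$, which are i.i.d. with marginals $F_1,F_2$; - incompletely observed data $\boldsymbol{X}^{(i)}=\big(X^{(i)}_{11},\dots,X^{(i)}_{1n_1},X^{(i)}_{21},\dots,X^{(i)}_{2n_2}\big)$, where $X^{(i)}_{11},\dots,X^{(i)}_{1n_1}\sim F_1$ are the first components of the $n_1$ subjects whose second component is missing, and $X^{(i)}_{21},\dots,X^{(i)}_{2n_2}\sim F_2$ are the second components of the $n_2$ subjects whose first component is missing; all these observations come from different subjects and are independent. Standing assumption: the missing mechanism is MCAR (missing completely at random), and $\boldsymbol{X}^{(c)}$ is independent of $\boldsymbol{X}^{(i)}$. The sample sizes $n_c,n_1,n_2$ are treated as fixed (non-random) numbers. Null hypothesis: $H_0$ is any set of distributions $P$ of the pairs in this model. Tests: a test is a measurable function of the data with values in $[0,1]$ (in particular it may be the indicator of a rejection region). A test $\psi$ is a level $\beta$ test for $H_0$ if $E_P(\psi)\le\beta$ for every $P\in H_0$. It is exact (at level $\beta$), written $E_{H_0}(\psi)=\beta$, if $E_P(\psi)=\beta$ for every $P\in H_0$. A family of tests $\psi=\psi_{n_c,n_1,n_2}$ is of asymptotic level $\beta$ if for every $P\in H_0$,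 $E_P(\psi_{n_c,n_1,n_2})\to\beta$ as $\min(n_c,n_1,n_2)\to\infty$. *)

theory Defs
  imports "HOL-Probability.Probability"
begin

(* Sample spaces. The incompletely observed data form one family indexed by
   {..<n1} <+> {..<n2}: index Inl j is the first component of the j-th subject whose
   second component is missing, Inr j the second component of the j-th subject whose
   first component is missing. *)

definition complete_space :: "nat \<Rightarrow> (nat \<Rightarrow> real \<times> real) measure" where
  "complete_space nc = (\<Pi>\<^sub>M j\<in>{..<nc}. borel)"

definition incomplete_space :: "nat \<Rightarrow> nat \<Rightarrow> (nat + nat \<Rightarrow> real) measure" where
  "incomplete_space n1 n2 = (\<Pi>\<^sub>M k\<in>{..<n1} <+> {..<n2}. borel)"

definition data_space ::
    "nat \<Rightarrow> nat \<Rightarrow> nat \<Rightarrow> ((nat \<Rightarrow> real \<times> real) \<times> (nat + nat \<Rightarrow> real)) measure" where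
  "data_space nc n1 n2 = complete_space nc \<Otimes>\<^sub>M incomplete_space n1 n2"

definition complete_data :: "nat \<Rightarrow> (nat \<Rightarrow> 'w \<Rightarrow> real \<times> real) \<Rightarrow> 'w \<Rightarrow> nat \<Rightarrow> real \<times> real" where
  "complete_data nc Xc \<omega> = (\<lambda>j\<in>{..<nc}. Xc j \<omega>)"

definition incomplete_data ::
    "nat \<Rightarrow> nat \<Rightarrow> (nat + nat \<Rightarrow> 'w \<Rightarrow> real) \<Rightarrow> 'w \<Rightarrow> nat + nat \<Rightarrow> real" where
  "incomplete_data n1 n2 Xi \<omega> = (\<lambda>k\<in>{..<n1} <+> {..<n2}. Xi k \<omega>)"

definition all_data ::
    "nat \<Rightarrow> nat \<Rightarrow> nat \<Rightarrow> (nat \<Rightarrow> 'w \<Rightarrow> real \<times> real) \<Rightarrow> (nat + nat \<Rightarrow> 'w \<Rightarrow> real) \<Rightarrow>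
      'w \<Rightarrow> (nat \<Rightarrow> real \<times> real) \<times> (nat + nat \<Rightarrow> real)" where
  "all_data nc n1 n2 Xc Xi \<omega> = (complete_data nc Xc \<omega>, incomplete_data n1 n2 Xi \<omega>)"

(* Library indep_var requires both variables to take values in the same type. *)

definition (in prob_space) indep_rv ::
    "'b measure \<Rightarrow> ('a \<Rightarrow> 'b) \<Rightarrow> 'c measure \<Rightarrow> ('a \<Rightarrow> 'c) \<Rightarrow> bool" where
  "indep_rv S X T Y \<longleftrightarrow> random_variable S X \<and> random_variable T Y \<and>
    indep_set {X -` A \<inter> space M | A. A \<in> sets S} {Y -` B \<inter> space M | B. B \<in> sets T}"

(* The matched pairs model with missing values, for fixed sample sizes, when P is the
   distribution of a pair; M is the underlying probability space. The marginal
   distribution functions F_1 and F_2 are represented by the image measures of P under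
   fst and snd. Missingness completely at random is what gives the incompletely observed
   components these unconditional marginals, and makes P the law of the complete pairs. *)

locale matched_pairs_model = prob_space M for M :: "'w measure" +
  fixes P :: "(real \<times> real) measure"
    and nc n1 n2 :: nat
    and Xc :: "nat \<Rightarrow> 'w \<Rightarrow> real \<times> real"
    and Xi :: "nat + nat \<Rightarrow> 'w \<Rightarrow> real"
  assumes prob_P: "prob_space P"
    and sets_P: "sets P = sets borel"
    and indep_complete: "indep_vars (\<lambda>_. borel) Xc {..<nc}"
    and distr_complete: "\<And>j. j < nc \<Longrightarrow> distr M borel (Xc j) = P"
    and indep_incomplete: "indep_vars (\<lambda>_. borel) Xi ({..<n1} <+> {..<n2})"
    and distr_incomplete_1: "\<And>j. j < n1 \<Longrightarrow> distr M borel (Xi (Inl j)) = distr P borel fst"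
    and distr_incomplete_2: "\<And>j. j < n2 \<Longrightarrow> distr M borel (Xi (Inr j)) = distr P borel snd"
    and indep_complete_incomplete:
      "indep_rv (complete_space nc) (complete_data nc Xc)
                (incomplete_space n1 n2) (incomplete_data n1 n2 Xi)"

(* Q P is the probability measure on the underlying space when P is the true distribution
   of the pairs. *)

definition matched_pairs_experiment ::
    "(real \<times> real) measure set \<Rightarrow> ((real \<times> real) measure \<Rightarrow> 'w measure) \<Rightarrow>
      nat \<Rightarrow> nat \<Rightarrow> nat \<Rightarrow> (nat \<Rightarrow> 'w \<Rightarrow> real \<times> real) \<Rightarrow> (nat + nat \<Rightarrow> 'w \<Rightarrow> real) \<Rightarrow> bool" where
  "matched_pairs_experiment H0 Q nc n1 n2 Xc Xi \<longleftrightarrow>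
    (\<forall>P\<in>H0. matched_pairs_model (Q P) P nc n1 n2 Xc Xi)"

definition is_test :: "'s measure \<Rightarrow> ('s \<Rightarrow> real) \<Rightarrow> bool" where
  "is_test S \<psi> \<longleftrightarrow> \<psi> \<in> borel_measurable S \<and> (\<forall>x\<in>space S. 0 \<le> \<psi> x \<and> \<psi> x \<le> 1)"

(* In the following notions X is the data on which the test is evaluated, with values in
   the sample space S. *)

definition level_test ::
    "'p set \<Rightarrow> ('p \<Rightarrow> 'w measure) \<Rightarrow> 's measure \<Rightarrow> ('w \<Rightarrow> 's) \<Rightarrow> real \<Rightarrow> ('s \<Rightarrow> real) \<Rightarrow> bool" where
  "level_test H0 Q S X \<beta> \<psi> \<longleftrightarrow> is_test S \<psi> \<and> (\<forall>P\<in>H0. (\<integral>\<omega>. \<psi> (X \<omega>) \<partial>Q P) \<le> \<beta>)"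

definition exact_test ::
    "'p set \<Rightarrow> ('p \<Rightarrow> 'w measure) \<Rightarrow> 's measure \<Rightarrow> ('w \<Rightarrow> 's) \<Rightarrow> real \<Rightarrow> ('s \<Rightarrow> real) \<Rightarrow> bool" where
  "exact_test H0 Q S X \<beta> \<psi> \<longleftrightarrow> is_test S \<psi> \<and> (\<forall>P\<in>H0. (\<integral>\<omega>. \<psi> (X \<omega>) \<partial>Q P) = \<beta>)"

definition min_size_at_top :: "(nat \<times> nat \<times> nat) filter" where
  "min_size_at_top = filtercomap (\<lambda>(nc, n1, n2). min nc (min n1 n2)) at_top"

definition asymptotic_level_test ::
    "'p set \<Rightarrow> (nat \<Rightarrow> nat \<Rightarrow> nat \<Rightarrow> 'p \<Rightarrow> 'w measure) \<Rightarrow> (nat \<Rightarrow> nat \<Rightarrow> nat \<Rightarrow> 's measure) \<Rightarrow>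
      (nat \<Rightarrow> nat \<Rightarrow> nat \<Rightarrow> 'w \<Rightarrow> 's) \<Rightarrow> real \<Rightarrow> (nat \<Rightarrow> nat \<Rightarrow> nat \<Rightarrow> 's \<Rightarrow> real) \<Rightarrow> bool" where
  "asymptotic_level_test H0 Q S X \<beta> \<psi> \<longleftrightarrow>
    (\<forall>nc n1 n2. is_test (S nc n1 n2) (\<psi> nc n1 n2)) \<and>
    (\<forall>P\<in>H0. ((\<lambda>(nc, n1, n2). \<integral>\<omega>. \<psi> nc n1 n2 (X nc n1 n2 \<omega>) \<partial>Q nc n1 n2 P) \<longlongrightarrow> \<beta>)
      min_size_at_top)"

definition product_test :: "('a \<Rightarrow> real) \<Rightarrow> ('b \<Rightarrow> real) \<Rightarrow> 'a \<times> 'b \<Rightarrow> real" where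
  "product_test \<phi>c \<phi>i = (\<lambda>(xc, xi). \<phi>c xc * \<phi>i xi)"

end

theory Submission
  imports Defs
begin

(* The expectation of a product of functions of independent data factorises; parts (i)
   and (ii) are then monotonicity and continuity of multiplication. *)

text \<open>Fix a distribution P in the null hypothesis. Under P the complete and the incomplete
  data are independent, so any measurable functions of the two are independent as well. Tests are
  bounded, hence integrable, and therefore E(\<phi>c * \<phi>i) = E(\<phi>c) * E(\<phi>i); this is
  \<open>expectation_product_test\<close>. Everything else is arithmetic of two nonnegative numbers:
  upper bounds multiply, equalities multiply, and limits multiply. The probabilistic work lies in
  \<open>indep_rv_compose_indep_var\<close>, which turns independence of two data vectors of
  different types into the \<open>indep_var\<close> of two real random variables, for which the
  product rule for expectations is known.\<close>

lemma vimage_compose_measurable_subset: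
  assumes X: "X \<in> measurable M S" and f: "f \<in> measurable S N"
  shows "{(\<lambda>\<omega>. f (X \<omega>)) -` A \<inter> space M | A. A \<in> sets N} \<subseteq> {X -` B \<inter> space M | B. B \<in> sets S}"
proof safe
  fix A assume "A \<in> sets N"
  then have "f -` A \<inter> space S \<in> sets S"
    by (rule measurable_sets[OF f])
  moreover have "(\<lambda>\<omega>. f (X \<omega>)) -` A \<inter> space M = X -` (f -` A \<inter> space S) \<inter> space M"
    using measurable_space[OF X] by auto
  ultimately show "\<exists>B. (\<lambda>\<omega>. f (X \<omega>)) -` A \<inter> space M = X -` B \<inter> space M \<and> B \<in> sets S"
    by blast
qed

text \<open>Preimages commute with intersections. Stability under intersection is what extends
  independence from these families to the sigma-algebras they generate.\<close>

lemma Int_stable_vimage_sets: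
  "Int_stable {X -` A \<inter> \<Omega> | A. A \<in> sets N}"
proof (rule Int_stableI)
  fix a b
  assume "a \<in> {X -` A \<inter> \<Omega> | A. A \<in> sets N}" "b \<in> {X -` A \<inter> \<Omega> | A. A \<in> sets N}"
  then obtain A B where "a = X -` A \<inter> \<Omega>" "b = X -` B \<inter> \<Omega>" "A \<in> sets N" "B \<in> sets N"
    by blast
  then show "a \<inter> b \<in> {X -` A \<inter> \<Omega> | A. A \<in> sets N}"
    by (intro CollectI exI[of _ "A \<inter> B"]) auto
qed

text \<open>An event expressed through \<open>f (X \<omega>)\<close> is already an event expressed
  through \<open>X \<omega>\<close>, so passing to functions only shrinks the two families, and
  independence is inherited. Since \<open>f\<close> and \<open>g\<close> share a codomain type, the
  result can be stated with \<open>indep_var\<close> although \<open>X\<close> and \<open>Y\<close>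
  have different types.\<close>

lemma (in prob_space) indep_rv_compose_indep_var:
  assumes XY: "indep_rv S X T Y" and f: "f \<in> measurable S N" and g: "g \<in> measurable T N'"
  shows "indep_var N (\<lambda>\<omega>. f (X \<omega>)) N' (\<lambda>\<omega>. g (Y \<omega>))"
proof -
  from XY have X: "X \<in> measurable M S" and Y: "Y \<in> measurable M T"
    and I: "indep_set {X -` A \<inter> space M | A. A \<in> sets S} {Y -` B \<inter> space M | B. B \<in> sets T}"
    by (auto simp: indep_rv_def)
  note fX = measurable_compose[OF X f] and gY = measurable_compose[OF Y g]
  have "indep_set {(\<lambda>\<omega>. f (X \<omega>)) -` A \<inter> space M | A. A \<in> sets N}
      {(\<lambda>\<omega>. g (Y \<omega>)) -` B \<inter> space M | B. B \<in> sets N'}" (is "indep_set ?F ?G")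
  proof (rule indep_setI)
    show "?F \<subseteq> events" "?G \<subseteq> events"
      using measurable_sets[OF fX] measurable_sets[OF gY] by auto
    fix a b assume "a \<in> ?F" "b \<in> ?G"
    then have "a \<in> {X -` A \<inter> space M | A. A \<in> sets S}"
        "b \<in> {Y -` B \<inter> space M | B. B \<in> sets T}"
      using vimage_compose_measurable_subset[OF X f] vimage_compose_measurable_subset[OF Y g]
      by blast+
    then show "prob (a \<inter> b) = prob a * prob b"
      by (rule indep_setD[OF I])
  qed
  \<comment> \<open>\<open>indep_var_eq\<close> speaks of generated sigma-algebras, hence the need
    for \<open>Int_stable_vimage_sets\<close>.\<close>
  then show ?thesis
    using fX gY by (simp add: indep_var_eq indep_set_sigma_sets Int_stable_vimage_sets)
qed

lemma is_test_product_test: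
  assumes "is_test (complete_space nc) \<phi>c" "is_test (incomplete_space n1 n2) \<phi>i"
  shows "is_test (data_space nc n1 n2) (product_test \<phi>c \<phi>i)"
proof -
  have [measurable]: "\<phi>c \<in> borel_measurable (complete_space nc)"
      "\<phi>i \<in> borel_measurable (incomplete_space n1 n2)"
    using assms by (auto simp: is_test_def)
  have "product_test \<phi>c \<phi>i \<in> borel_measurable (data_space nc n1 n2)"
    unfolding product_test_def data_space_def by measurable
  then show ?thesis
    using assms by (auto simp: is_test_def product_test_def data_space_def space_pair_measure
        intro!: mult_le_one)
qed

text \<open>A test is bounded only on \<open>space S\<close>; measurability of \<open>X\<close>
  keeps the data there. Integrability serves the product rule, nonnegativity the multiplication of
  inequalities.\<close>

lemma (in prob_space) expectation_test_bounds:
  assumes X: "X \<in> measurable M S" and "is_test S \<psi>"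
  shows "integrable M (\<lambda>\<omega>. \<psi> (X \<omega>))" and "0 \<le> expectation (\<lambda>\<omega>. \<psi> (X \<omega>))"
proof -
  have \<psi>: "\<psi> \<in> borel_measurable S" and b: "\<And>x. x \<in> space S \<Longrightarrow> 0 \<le> \<psi> x \<and> \<psi> x \<le> 1"
    using assms(2) by (auto simp: is_test_def)
  show "integrable M (\<lambda>\<omega>. \<psi> (X \<omega>))"
    using measurable_compose[OF X \<psi>] b measurable_space[OF X]
    by (intro integrable_const_bound[where B = 1]) auto
  show "0 \<le> expectation (\<lambda>\<omega>. \<psi> (X \<omega>))"
    using b measurable_space[OF X] by (intro Bochner_Integration.integral_nonneg) auto
qed

context matched_pairs_model
begin

lemma measurable_data:
  shows "complete_data nc Xc \<in> measurable M (complete_space nc)"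
    and "incomplete_data n1 n2 Xi \<in> measurable M (incomplete_space n1 n2)"
  using indep_complete_incomplete by (auto simp: indep_rv_def)

lemma expectation_product_test:
  assumes c: "is_test (complete_space nc) \<phi>c" and i: "is_test (incomplete_space n1 n2) \<phi>i"
  shows "expectation (\<lambda>\<omega>. product_test \<phi>c \<phi>i (all_data nc n1 n2 Xc Xi \<omega>)) =
    expectation (\<lambda>\<omega>. \<phi>c (complete_data nc Xc \<omega>)) *
    expectation (\<lambda>\<omega>. \<phi>i (incomplete_data n1 n2 Xi \<omega>))"
proof -
  have "indep_var borel (\<lambda>\<omega>. \<phi>c (complete_data nc Xc \<omega>))
      borel (\<lambda>\<omega>. \<phi>i (incomplete_data n1 n2 Xi \<omega>))"
    using c i by (intro indep_rv_compose_indep_var[OF indep_complete_incomplete])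
      (auto simp: is_test_def)
  then show ?thesis
    using expectation_test_bounds(1)[OF measurable_data(1) c]
      expectation_test_bounds(1)[OF measurable_data(2) i]
    by (simp add: indep_var_lebesgue_integral product_test_def all_data_def)
qed

end

lemma level_test_product_test:
  assumes E: "matched_pairs_experiment H0 Q nc n1 n2 Xc Xi" and "0 \<le> \<alpha>1"
    and c: "level_test H0 Q (complete_space nc) (complete_data nc Xc) \<alpha>1 \<phi>c"
    and i: "level_test H0 Q (incomplete_space n1 n2) (incomplete_data n1 n2 Xi) \<alpha>2 \<phi>i"
  shows "level_test H0 Q (data_space nc n1 n2) (all_data nc n1 n2 Xc Xi) (\<alpha>1 * \<alpha>2)
    (product_test \<phi>c \<phi>i)"
  unfolding level_test_def
proof (intro conjI ballI)
  have tests: "is_test (complete_space nc) \<phi>c" "is_test (incomplete_space n1 n2) \<phi>i"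
    using c i by (auto simp: level_test_def)
  then show "is_test (data_space nc n1 n2) (product_test \<phi>c \<phi>i)"
    by (rule is_test_product_test)
  fix P assume "P \<in> H0"
  then interpret matched_pairs_model "Q P" P nc n1 n2 Xc Xi
    using E by (simp add: matched_pairs_experiment_def)
  show "expectation (\<lambda>\<omega>. product_test \<phi>c \<phi>i (all_data nc n1 n2 Xc Xi \<omega>)) \<le> \<alpha>1 * \<alpha>2"
    unfolding expectation_product_test[OF tests]
    using c i \<open>P \<in> H0\<close> \<open>0 \<le> \<alpha>1\<close> expectation_test_bounds(2)[OF measurable_data(2) tests(2)]
    \<comment> \<open>Multiplying the two bounds needs \<open>0 \<le> \<alpha>1\<close> and a
      nonnegative expectation of \<open>\<phi>i\<close>.\<close>
    by (intro mult_mono) (auto simp: level_test_def)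
qed

lemma exact_test_product_test:
  assumes E: "matched_pairs_experiment H0 Q nc n1 n2 Xc Xi"
    and c: "exact_test H0 Q (complete_space nc) (complete_data nc Xc) \<alpha>1 \<phi>c"
    and i: "exact_test H0 Q (incomplete_space n1 n2) (incomplete_data n1 n2 Xi) \<alpha>2 \<phi>i"
  shows "exact_test H0 Q (data_space nc n1 n2) (all_data nc n1 n2 Xc Xi) (\<alpha>1 * \<alpha>2)
    (product_test \<phi>c \<phi>i)"
  using assms
  by (auto simp: exact_test_def matched_pairs_experiment_def is_test_product_test
      matched_pairs_model.expectation_product_test)

lemma asymptotic_level_test_product_test:
  assumes E: "\<And>nc n1 n2. matched_pairs_experiment H0 (Q nc n1 n2) nc n1 n2
      (Xc nc n1 n2) (Xi nc n1 n2)"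
    and c: "asymptotic_level_test H0 Q (\<lambda>nc n1 n2. complete_space nc)
      (\<lambda>nc n1 n2. complete_data nc (Xc nc n1 n2)) \<alpha>1 \<phi>c"
    and i: "asymptotic_level_test H0 Q (\<lambda>nc n1 n2. incomplete_space n1 n2)
      (\<lambda>nc n1 n2. incomplete_data n1 n2 (Xi nc n1 n2)) \<alpha>2 \<phi>i"
  shows "asymptotic_level_test H0 Q data_space
    (\<lambda>nc n1 n2. all_data nc n1 n2 (Xc nc n1 n2) (Xi nc n1 n2)) (\<alpha>1 * \<alpha>2)
    (\<lambda>nc n1 n2. product_test (\<phi>c nc n1 n2) (\<phi>i nc n1 n2))"
  unfolding asymptotic_level_test_def
proof (intro conjI allI ballI)
  have tests: "is_test (complete_space nc) (\<phi>c nc n1 n2)"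
      "is_test (incomplete_space n1 n2) (\<phi>i nc n1 n2)" for nc n1 n2
    using c i by (auto simp: asymptotic_level_test_def)
  then show "is_test (data_space nc n1 n2) (product_test (\<phi>c nc n1 n2) (\<phi>i nc n1 n2))"
    for nc n1 n2
    by (intro is_test_product_test)
  fix P assume P: "P \<in> H0"
  then have "matched_pairs_model (Q nc n1 n2 P) P nc n1 n2 (Xc nc n1 n2) (Xi nc n1 n2)"
    for nc n1 n2
    using E by (simp add: matched_pairs_experiment_def)
  \<comment> \<open>The factorisation holds at every triple of sample sizes, even if the underlying
    measure varies with the triple; only the two factors have to be passed to the limit.\<close>
  note eq = matched_pairs_model.expectation_product_test[OF this tests]
  have "((\<lambda>n. (case n of (nc, n1, n2) \<Rightarrow>
          \<integral>\<omega>. \<phi>c nc n1 n2 (complete_data nc (Xc nc n1 n2) \<omega>) \<partial>Q nc n1 n2 P) *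
        (case n of (nc, n1, n2) \<Rightarrow>
          \<integral>\<omega>. \<phi>i nc n1 n2 (incomplete_data n1 n2 (Xi nc n1 n2) \<omega>) \<partial>Q nc n1 n2 P))
      \<longlongrightarrow> \<alpha>1 * \<alpha>2) min_size_at_top"
    using c i P by (intro tendsto_mult) (auto simp: asymptotic_level_test_def)
  then show "((\<lambda>(nc, n1, n2). \<integral>\<omega>. product_test (\<phi>c nc n1 n2) (\<phi>i nc n1 n2)
        (all_data nc n1 n2 (Xc nc n1 n2) (Xi nc n1 n2) \<omega>) \<partial>Q nc n1 n2 P)
      \<longlongrightarrow> \<alpha>1 * \<alpha>2) min_size_at_top"
    by (simp add: eq case_prod_unfold)
qed

theorem theorem1p1:
  fixes \<alpha>1 \<alpha>2 \<alpha> :: real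
    and H0 :: "(real \<times> real) measure set"
  assumes "\<alpha>1 \<in> {0<..<1}" and "\<alpha>2 \<in> {0<..<1}" and "\<alpha> = \<alpha>1 * \<alpha>2"
  shows
    "(\<forall>nc n1 n2 (Q :: (real \<times> real) measure \<Rightarrow> 'w measure) Xc Xi \<phi>c \<phi>i.
        matched_pairs_experiment H0 Q nc n1 n2 Xc Xi \<longrightarrow>
        (level_test H0 Q (complete_space nc) (complete_data nc Xc) \<alpha>1 \<phi>c \<and>
         level_test H0 Q (incomplete_space n1 n2) (incomplete_data n1 n2 Xi) \<alpha>2 \<phi>i \<longrightarrow>
         level_test H0 Q (data_space nc n1 n2) (all_data nc n1 n2 Xc Xi) \<alpha>
           (product_test \<phi>c \<phi>i)) \<and>
        (exact_test H0 Q (complete_space nc) (complete_data nc Xc) \<alpha>1 \<phi>c \<and>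
         exact_test H0 Q (incomplete_space n1 n2) (incomplete_data n1 n2 Xi) \<alpha>2 \<phi>i \<longrightarrow>
         exact_test H0 Q (data_space nc n1 n2) (all_data nc n1 n2 Xc Xi) \<alpha>
           (product_test \<phi>c \<phi>i))) \<and>
     (\<forall>(Q :: nat \<Rightarrow> nat \<Rightarrow> nat \<Rightarrow> (real \<times> real) measure \<Rightarrow> 'w measure) Xc Xi \<phi>c \<phi>i.
        (\<forall>nc n1 n2. matched_pairs_experiment H0 (Q nc n1 n2) nc n1 n2
           (Xc nc n1 n2) (Xi nc n1 n2)) \<longrightarrow>
        asymptotic_level_test H0 Q (\<lambda>nc n1 n2. complete_space nc)
          (\<lambda>nc n1 n2. complete_data nc (Xc nc n1 n2)) \<alpha>1 \<phi>c \<and>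
        asymptotic_level_test H0 Q (\<lambda>nc n1 n2. incomplete_space n1 n2)
          (\<lambda>nc n1 n2. incomplete_data n1 n2 (Xi nc n1 n2)) \<alpha>2 \<phi>i \<longrightarrow>
        asymptotic_level_test H0 Q data_space
          (\<lambda>nc n1 n2. all_data nc n1 n2 (Xc nc n1 n2) (Xi nc n1 n2)) \<alpha>
          (\<lambda>nc n1 n2. product_test (\<phi>c nc n1 n2) (\<phi>i nc n1 n2)))"
  unfolding \<open>\<alpha> = \<alpha>1 * \<alpha>2\<close>
  \<comment> \<open>Positivity of \<alpha>1 supplies the premise \<open>0 \<le> \<alpha>1\<close> of
    \<open>level_test_product_test\<close>.\<close>
  using assms(1)
  by (intro conjI allI impI)
    (auto intro: level_test_product_test exact_test_product_test
      asymptotic_level_test_product_test)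

end
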